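(* Let $W:\mathbb{N}^{\star}\times\mathbb{N}^{\star}\to\mathbb{C}$ be a function and let $\square$ be the $W$-convolution, $[F\,\square\,G](m)=\sum_{ab=m}F(a)G(b)W(a,b)$. Let $\times$ denote the pointwise product. Then $(\mathbb{M},\square,\times)$ is a commutative ring (with $\square$ as addition and $\times$ as multiplication) if and only if for all $a,b\in\mathbb{N}^{\star}$ $$W(a,b)=\begin{cases}1 & \text{if }\gcd(a,b)=1,\\ 0&\text{otherwise.}\end{cases}$$
   Context: $\mathbb{N}^{\star}$ is the set of positive integers. $\mathbb{M}$ is the set of multiplicative functions: $F:\mathbb{N}^{\star}\to\mathbb{C}$ with $F(1)=1$ and $F(ab)=F(a)F(b)$ whenever $\gcd(a,b)=1$. For a weight function $W:(\mathbb{N}^{\star})^2\to\mathbb{C}$ and $F,G\in\mathbb{M}$, $m\in\mathbb{N}^{\star}$: $[F\,\square\,G](m)=\sum_{ab=m}F(a)G(b)W(a,b)$, the sum over ordered pairs of positive integers $(a,b)$ with $ab=m$, and $[F\times G](m)=F(m)G(m)$. Being a ring includes that $\mathbb{M}$ is closed under $\square$ and $\times$, and that both operations have identity elements. *)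

theory Defs
  imports Complex_Main "HOL-Algebra.Ring"
begin

text \<open>
  Functions on the positive integers are represented by functions on \<^typ>\<open>nat\<close> that vanish
  at \<open>0\<close>. This fixes the irrelevant value, so that each arithmetic function has exactly one
  representative and equality in the carrier is equality on the positive integers.
\<close>

definition mult_funs :: "(nat \<Rightarrow> complex) set" where
  "mult_funs = {F. F 0 = 0 \<and> F 1 = 1 \<and>
     (\<forall>a>0. \<forall>b>0. coprime a b \<longrightarrow> F (a * b) = F a * F b)}"

text \<open>
  For \<open>m = 0\<close> the index set below is empty, so the value is \<open>0\<close>, as the convention requires.
  The values of \<open>W\<close> at arguments that are \<open>0\<close> are never used.
\<close>

definition W_conv ::
    "(nat \<Rightarrow> nat \<Rightarrow> complex) \<Rightarrow> (nat \<Rightarrow> complex) \<Rightarrow> (nat \<Rightarrow> complex) \<Rightarrow> nat \<Rightarrow> complex" where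
  "W_conv W F G m = (\<Sum>(a, b) \<in> {(a, b). 0 < a \<and> 0 < b \<and> a * b = m}. F a * G b * W a b)"

definition pointwise_mult :: "(nat \<Rightarrow> complex) \<Rightarrow> (nat \<Rightarrow> complex) \<Rightarrow> nat \<Rightarrow> complex" where
  "pointwise_mult F G m = F m * G m"

text \<open>
  A \<open>ring\<close> record carries its identity elements as data, whereas being a ring only asserts
  that they exist; hence the existential quantifiers.
\<close>

definition forms_comm_ring ::
    "'a set \<Rightarrow> ('a \<Rightarrow> 'a \<Rightarrow> 'a) \<Rightarrow> ('a \<Rightarrow> 'a \<Rightarrow> 'a) \<Rightarrow> bool" where
  "forms_comm_ring A p t \<longleftrightarrow>
     (\<exists>z u. cring \<lparr>carrier = A, mult = t, one = u, zero = z, add = p\<rparr>)"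

end

theory Submission
  imports "HOL-Computational_Algebra.Primes" Defs
begin

text \<open>
  Sufficiency. When \<open>W\<close> is the indicator of coprime pairs, \<open>\<box>\<close> is the unitary convolution, a sum
  over the factorizations \<open>m = a * b\<close> with \<open>a\<close> and \<open>b\<close> coprime. If \<open>m\<close> and \<open>n\<close> are coprime, the
  coprime factorizations of \<open>m * n\<close> are the products of those of \<open>m\<close> and of \<open>n\<close>, so multiplicative
  functions are closed under it (\<open>unitary_conv_mult_funs\<close>). A prime power \<open>q > 1\<close> has only the
  coprime factorizations \<open>1 * q\<close> and \<open>q * 1\<close>, so the convolution adds the values at \<open>q\<close>. A
  multiplicative function is determined by its values at prime powers
  (\<open>mult_funs_eqI_prime_power\<close>). Therefore associativity and distributivity reduce to
  the same laws for complex numbers. The additive identity is \<open>I\<^sub>1\<close> below, and an additive inverse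
  of \<open>F\<close> is \<open>F\<close> times \<open>-1\<close> to the number of distinct prime factors, as this negates \<open>F\<close> at every
  prime power \<open>q > 1\<close>.

  Necessity. Let \<open>I\<^sub>n\<close> be the indicator of the unitary divisors of \<open>n\<close>; it is multiplicative. In
  \<open>[I\<^sub>a \<box> I\<^sub>b](a * b)\<close> a factorization \<open>c * d = a * b\<close> contributes only if \<open>c\<close> divides \<open>a\<close> and \<open>d\<close>
  divides \<open>b\<close>, hence only if \<open>(c, d) = (a, b)\<close>. So this value is \<open>W(a, b)\<close>: the functions
  \<open>I\<^sub>n\<close> isolate single weights.
  The zero \<open>z\<close> of the ring satisfies \<open>z \<times> I\<^sub>1 = z\<close>, which forces \<open>z = I\<^sub>1\<close>, and neutrality of \<open>z\<close>
  then gives \<open>W(1, m) = W(m, 1) = 1\<close>. If \<open>a\<close> and \<open>b\<close> are coprime, closure under \<open>\<box>\<close> gives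
  \<open>W(a, b) = [I\<^sub>a \<box> I\<^sub>b](a) [I\<^sub>a \<box> I\<^sub>b](b) = W(a, 1) W(1, b) = 1\<close>. If they are not, multiplying
  \<open>I\<^sub>a \<box> I\<^sub>b\<close> by \<open>F = I\<^bsub>a * b\<^esub>\<close> and distributing, then evaluating at \<open>a * b\<close>, gives
  \<open>W(a, b) F(a * b) = W(a, b) F(a) F(b)\<close>; here \<open>F(a * b) = 1\<close>, whereas \<open>F(a) = 0\<close> because \<open>a\<close> is
  not a unitary divisor of \<open>a * b\<close>, and so \<open>W(a, b) = 0\<close>.
\<close>

section \<open>Multiplicative functions\<close>

lemma mult_funsI:
  assumes "F 0 = 0" "F 1 = 1"
    and "\<And>a b. 0 < a \<Longrightarrow> 0 < b \<Longrightarrow> coprime a b \<Longrightarrow> F (a * b) = F a * F b"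
  shows "F \<in> mult_funs"
  using assms by (auto simp: mult_funs_def)

lemma mult_funs_0: "F \<in> mult_funs \<Longrightarrow> F 0 = 0"
  and mult_funs_1: "F \<in> mult_funs \<Longrightarrow> F (Suc 0) = 1"
  and mult_funs_mult:
    "F \<in> mult_funs \<Longrightarrow> 0 < a \<Longrightarrow> 0 < b \<Longrightarrow> coprime a b \<Longrightarrow> F (a * b) = F a * F b"
  by (auto simp: mult_funs_def)

lemma pointwise_mult_mult_funs:
  "F \<in> mult_funs \<Longrightarrow> G \<in> mult_funs \<Longrightarrow> pointwise_mult F G \<in> mult_funs"
  by (rule mult_funsI) (auto simp: pointwise_mult_def mult_funs_0 mult_funs_1 mult_funs_mult)

definition const_one :: "nat \<Rightarrow> complex" where
  "const_one m = (if m = 0 then 0 else 1)"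

lemma const_one_mult_funs: "const_one \<in> mult_funs"
  by (rule mult_funsI) (auto simp: const_one_def)

lemma prime_power_gt_1_nat:
  fixes p k :: nat
  assumes "prime p" "0 < k"
  shows "1 < p ^ k"
  using assms by (intro one_less_power prime_gt_1_nat)

text \<open>
  Splitting off the full power of one prime writes any \<open>m > 1\<close> as a product of a prime power and a
  smaller coprime factor.
\<close>

lemma mult_funs_eqI_prime_power:
  assumes F: "F \<in> mult_funs" and G: "G \<in> mult_funs"
    and eq: "\<And>p k. prime p \<Longrightarrow> 0 < k \<Longrightarrow> F (p ^ k) = G (p ^ k)"
  shows "F = G"
proof
  fix m
  show "F m = G m"
  proof (induction m rule: less_induct)
    case (less m)
    consider "m = 0" | "m = 1" | "m > 1" by linarith
    then show ?case
    proof cases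
      case 3
      then obtain p where p: "prime p" "p dvd m"
        using prime_factor_nat[of m] by auto
      define k where "k = multiplicity p m"
      have "m \<noteq> 0" "\<not> is_unit p" using 3 p(1) by auto
      then obtain r where r: "m = p ^ k * r" "\<not> p dvd r"
        unfolding k_def by (rule multiplicity_decompose')
      have k: "0 < k" using r p by (cases k) auto
      have cop: "coprime (p ^ k) r"
        using p r by (simp add: prime_imp_coprime)
      have pos: "0 < p ^ k" "0 < r" using r 3 p by (auto simp: prime_gt_0_nat intro!: Nat.gr0I)
      have "1 < p ^ k" using p(1) k by (rule prime_power_gt_1_nat)
      then have "r < m" using r pos by simp
      then show ?thesis
        using less.IH[of r] eq[OF p(1) k] mult_funs_mult[OF F pos cop] mult_funs_mult[OF G pos cop] r
        by simp
    qed (use F G in \<open>auto simp: mult_funs_0 mult_funs_1\<close>)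
  qed
qed

section \<open>The unitary convolution\<close>

definition coprime_splittings :: "nat \<Rightarrow> (nat \<times> nat) set" where
  "coprime_splittings m = {(a, b). 0 < a \<and> 0 < b \<and> coprime a b \<and> a * b = m}"

definition unitary_conv :: "(nat \<Rightarrow> complex) \<Rightarrow> (nat \<Rightarrow> complex) \<Rightarrow> nat \<Rightarrow> complex" where
  "unitary_conv F G m = (\<Sum>(a, b) \<in> coprime_splittings m. F a * G b)"

lemma finite_splittings: "finite {(a, b). 0 < a \<and> 0 < b \<and> a * b = (m::nat)}"
  by (rule finite_subset[of _ "{..m} \<times> {..m}"]) auto

lemma W_conv_eq_unitary_conv:
  assumes "\<forall>a>0. \<forall>b>0. W a b = (if gcd a b = 1 then 1 else 0)"
  shows "W_conv W = unitary_conv"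
proof (intro ext)
  fix F G m
  have W: "W a b = (if coprime a b then 1 else 0)" if "0 < a" "0 < b" for a b
    using assms that by (simp add: coprime_iff_gcd_eq_1)
  show "W_conv W F G m = unitary_conv F G m"
    unfolding W_conv_def unitary_conv_def
    by (rule sum.mono_neutral_cong_right[OF finite_splittings])
      (auto simp: coprime_splittings_def W split: if_splits)
qed

lemma unitary_conv_0: "unitary_conv F G 0 = 0"
proof -
  have "coprime_splittings 0 = {}" by (auto simp: coprime_splittings_def)
  then show ?thesis by (simp add: unitary_conv_def)
qed

lemma unitary_conv_1: "unitary_conv F G 1 = F 1 * G 1"
proof -
  have "coprime_splittings 1 = {(1, 1)}" by (auto simp: coprime_splittings_def)
  then show ?thesis by (simp add: unitary_conv_def)
qed

lemma unitary_conv_commute: "unitary_conv F G = unitary_conv G F"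
  unfolding unitary_conv_def
  by (intro ext sum.reindex_bij_witness[of _ "\<lambda>(a, b). (b, a)" "\<lambda>(a, b). (b, a)"])
    (auto simp: coprime_splittings_def coprime_commute mult.commute)

lemma gcd_mult_gcd_of_coprime:
  fixes x m n :: nat
  assumes "coprime m n"
  shows "gcd x m * gcd x n = gcd x (m * n)"
proof (rule dvd_antisym)
  have "coprime (gcd x m) (gcd x n)"
    using assms by (meson coprime_divisors gcd_dvd2)
  then show "gcd x m * gcd x n dvd gcd x (m * n)"
    by (intro gcd_greatest divides_mult) (auto intro: mult_dvd_mono)
  have "gcd x (m * n) dvd gcd (x * n) (m * n)"
    by (intro gcd_greatest) auto
  also have "gcd (x * n) (m * n) = gcd x m * n"
    by (simp add: gcd_mult_distrib_nat mult.commute)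
  finally have "gcd x (m * n) dvd gcd (gcd x m * x) (gcd x m * n)"
    by (intro gcd_greatest) auto
  then show "gcd x (m * n) dvd gcd x m * gcd x n"
    by (simp add: gcd_mult_distrib_nat)
qed

text \<open>
  If \<open>m\<close> and \<open>n\<close> are coprime, coprime factorizations of \<open>m\<close> and \<open>n\<close> multiply to one of \<open>m * n\<close>, and
  they are recovered from it by taking greatest common divisors with \<open>m\<close> and \<open>n\<close>. This splits
  the sum at \<open>m * n\<close> into a product.
\<close>

lemma unitary_conv_mult_funs:
  assumes F: "F \<in> mult_funs" and G: "G \<in> mult_funs"
  shows "unitary_conv F G \<in> mult_funs"
proof (rule mult_funsI)
  show "unitary_conv F G 0 = 0" by (rule unitary_conv_0)
  show "unitary_conv F G 1 = 1"
    using F G by (simp add: unitary_conv_1[simplified] mult_funs_1)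
next
  fix m n :: nat
  assume pos: "0 < m" "0 < n" and cop: "coprime m n"
  let ?S = "coprime_splittings"
  have join: "coprime (a * c) (b * d)" "coprime a c" "coprime b d"
      "gcd (a * c) m = a" "gcd (b * d) m = b" "gcd (a * c) n = c" "gcd (b * d) n = d"
    if "(a, b) \<in> ?S m" "(c, d) \<in> ?S n" for a b c d
  proof -
    have mn: "m = a * b" "n = c * d" "coprime a b" "coprime c d"
      using that by (auto simp: coprime_splittings_def)
    with cop have c: "coprime a c" "coprime a d" "coprime b c" "coprime b d" by auto
    show "coprime a c" "coprime b d" by fact+
    show "coprime (a * c) (b * d)"
      using c mn by (auto simp: coprime_commute)
    show "gcd (a * c) m = a"
      using c mn gcd_mult_distrib_nat[of a c b] by (simp add: coprime_commute)
    show "gcd (b * d) m = b"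
      using c mn gcd_mult_distrib_nat[of b d a] by (simp add: coprime_commute mult.commute)
    show "gcd (a * c) n = c"
      using c mn gcd_mult_distrib_nat[of c a d] by (simp add: coprime_commute mult.commute)
    show "gcd (b * d) n = d"
      using c mn gcd_mult_distrib_nat[of d b c] by (simp add: coprime_commute mult.commute)
  qed
  have split: "gcd x m * gcd x n = x" "gcd y m * gcd y n = y"
      "gcd x m * gcd y m = m" "gcd x n * gcd y n = n"
      "coprime (gcd x m) (gcd y m)" "coprime (gcd x n) (gcd y n)"
    if "(x, y) \<in> ?S (m * n)" for x y
  proof -
    have xy: "x * y = m * n" "coprime x y"
      using that by (auto simp: coprime_splittings_def)
    have "x dvd m * n" "y dvd m * n" using xy(1) by (metis dvd_triv_left dvd_triv_right)+
    then show "gcd x m * gcd x n = x" "gcd y m * gcd y n = y"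
      by (simp_all add: gcd_mult_gcd_of_coprime[OF cop] gcd_proj1_if_dvd_nat)
    have "m dvd x * y" "n dvd x * y" by (simp_all add: xy(1))
    then show "gcd x m * gcd y m = m" "gcd x n * gcd y n = n"
      using gcd_mult_gcd_of_coprime[OF xy(2), of m] gcd_mult_gcd_of_coprime[OF xy(2), of n]
      by (simp_all add: gcd.commute gcd_proj1_if_dvd_nat)
    show "coprime (gcd x m) (gcd y m)" "coprime (gcd x n) (gcd y n)"
      using xy(2) by (meson coprime_divisors gcd_dvd1)+
  qed
  have "unitary_conv F G m * unitary_conv F G n =
      (\<Sum>((a, b), (c, d)) \<in> ?S m \<times> ?S n. (F a * G b) * (F c * G d))"
    unfolding unitary_conv_def
    by (simp add: sum_product sum.cartesian_product case_prod_unfold)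
  also have "\<dots> = (\<Sum>(x, y) \<in> ?S (m * n). F x * G y)"
  proof (rule sum.reindex_bij_witness[of _
        "\<lambda>(x, y). ((gcd x m, gcd y m), (gcd x n, gcd y n))"
        "\<lambda>((a, b), (c, d)). (a * c, b * d)"], goal_cases)
    case (1 q)
    obtain a b c d where q: "q = ((a, b), (c, d))" by (metis surj_pair)
    then show ?case using 1 join(4-7)[of a b c d] by simp
  next
    case (2 q)
    obtain a b c d where q: "q = ((a, b), (c, d))" by (metis surj_pair)
    with 2 have S: "(a, b) \<in> ?S m" "(c, d) \<in> ?S n" by auto
    then have "0 < a * c" "0 < b * d" "(a * c) * (b * d) = m * n"
      by (auto simp: coprime_splittings_def)
    then show ?case using join(1)[OF S] q by (simp add: coprime_splittings_def)
  next
    case (3 q)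
    obtain x y where q: "q = (x, y)" by (metis surj_pair)
    then show ?case using 3 split(1,2)[of x y] by simp
  next
    case (4 q)
    obtain x y where q: "q = (x, y)" by (metis surj_pair)
    then show ?case using 4 split(3-6)[of x y] pos by (simp add: coprime_splittings_def)
  next
    case (5 q)
    obtain a b c d where q: "q = ((a, b), (c, d))" by (metis surj_pair)
    then have S: "(a, b) \<in> ?S m" "(c, d) \<in> ?S n" using 5 by auto
    then have "0 < a" "0 < b" "0 < c" "0 < d" by (auto simp: coprime_splittings_def)
    then show ?case using q mult_funs_mult[OF F, of a c] mult_funs_mult[OF G, of b d] join[OF S]
      by (simp add: algebra_simps)
  qed
  finally show "unitary_conv F G (m * n) = unitary_conv F G m * unitary_conv F G n"
    by (simp add: unitary_conv_def)
qed

text \<open>Two coprime powers of the same prime cannot both exceed \<open>1\<close>.\<close>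

lemma unitary_conv_prime_power:
  assumes F: "F \<in> mult_funs" and G: "G \<in> mult_funs" and p: "prime p" and k: "0 < k"
  shows "unitary_conv F G (p ^ k) = F (p ^ k) + G (p ^ k)"
proof -
  have gt: "1 < p ^ k" using p k by (rule prime_power_gt_1_nat)
  have "coprime_splittings (p ^ k) = {(1, p ^ k), (p ^ k, 1)}"
  proof (intro Set.set_eqI iffI)
    fix x assume "x \<in> coprime_splittings (p ^ k)"
    then obtain a b where ab: "x = (a, b)" "coprime a b" "a * b = p ^ k"
      by (auto simp: coprime_splittings_def)
    then obtain i j where ij: "a = p ^ i" "b = p ^ j"
      using p by (metis divides_primepow_nat dvd_triv_left dvd_triv_right)
    with ab p have "i = 0 \<or> j = 0" by (auto simp: prime_nat_iff)
    then show "x \<in> {(1, p ^ k), (p ^ k, 1)}" using ab ij by auto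
  qed (use p in \<open>auto simp: coprime_splittings_def prime_gt_0_nat\<close>)
  then show ?thesis using gt F G by (simp add: unitary_conv_def mult_funs_1 add.commute)
qed

text \<open>
  At a prime power both sides are sums of complex numbers, so this law and the next come from those
  of addition and multiplication there.
\<close>

lemma unitary_conv_assoc:
  assumes "F \<in> mult_funs" "G \<in> mult_funs" "H \<in> mult_funs"
  shows "unitary_conv (unitary_conv F G) H = unitary_conv F (unitary_conv G H)"
  by (rule mult_funs_eqI_prime_power)
    (use assms in \<open>auto simp: unitary_conv_mult_funs unitary_conv_prime_power\<close>)

lemma unitary_conv_distrib:
  assumes "F \<in> mult_funs" "G \<in> mult_funs" "H \<in> mult_funs"
  shows "pointwise_mult (unitary_conv F G) H =
    unitary_conv (pointwise_mult F H) (pointwise_mult G H)"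
proof (rule mult_funs_eqI_prime_power)
  fix p k :: nat
  assume "prime p" "0 < k"
  then show "pointwise_mult (unitary_conv F G) H (p ^ k) =
      unitary_conv (pointwise_mult F H) (pointwise_mult G H) (p ^ k)"
    using assms
    by (simp add: unitary_conv_prime_power pointwise_mult_mult_funs)
      (simp add: pointwise_mult_def unitary_conv_prime_power distrib_right)
qed (use assms in \<open>auto simp: unitary_conv_mult_funs pointwise_mult_mult_funs\<close>)

section \<open>Indicators of unitary divisors\<close>

definition unitary_divisor :: "nat \<Rightarrow> nat \<Rightarrow> bool" where
  "unitary_divisor d n \<longleftrightarrow> (\<exists>e. n = d * e \<and> coprime d e)"

definition unitary_indicator :: "nat \<Rightarrow> nat \<Rightarrow> complex" where
  "unitary_indicator n d = (if unitary_divisor d n then 1 else 0)"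

lemma unitary_divisor_imp_dvd: "unitary_divisor d n \<Longrightarrow> d dvd n"
  by (auto simp: unitary_divisor_def)

lemma unitary_indicator_self: "unitary_indicator n n = 1"
  by (auto simp: unitary_indicator_def unitary_divisor_def intro: exI[of _ 1])

lemma unitary_divisor_mult_left_iff:
  assumes "0 < a"
  shows "unitary_divisor a (a * b) \<longleftrightarrow> coprime a b"
  using assms by (auto simp: unitary_divisor_def)

lemma unitary_divisor_mult_iff:
  assumes "0 < c" "0 < d" "coprime c d"
  shows "unitary_divisor (c * d) n \<longleftrightarrow> unitary_divisor c n \<and> unitary_divisor d n"
proof
  assume "unitary_divisor (c * d) n"
  then obtain e where "n = c * d * e" "coprime (c * d) e"
    by (auto simp: unitary_divisor_def)
  then have "n = c * (d * e)" "coprime c (d * e)" "n = d * (c * e)" "coprime d (c * e)"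
    using assms by (auto simp: coprime_commute)
  then show "unitary_divisor c n \<and> unitary_divisor d n"
    unfolding unitary_divisor_def by blast
next
  assume "unitary_divisor c n \<and> unitary_divisor d n"
  then obtain k l where kl: "n = c * k" "coprime c k" "n = d * l" "coprime d l"
    unfolding unitary_divisor_def by blast
  have "d dvd c * k" using kl by (metis dvd_triv_left)
  then have "d dvd k"
    using assms(3) by (simp add: coprime_dvd_mult_right_iff coprime_commute)
  then obtain e where e: "k = d * e" ..
  with kl assms have "l = c * e" by auto
  with e kl have "n = c * d * e" "coprime (c * d) e" by auto
  then show "unitary_divisor (c * d) n" unfolding unitary_divisor_def by blast
qed

lemma unitary_indicator_mult_funs:
  assumes "0 < n"
  shows "unitary_indicator n \<in> mult_funs"
proof (rule mult_funsI)
  show "unitary_indicator n 0 = 0" "unitary_indicator n 1 = 1"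
    using assms by (auto simp: unitary_indicator_def unitary_divisor_def)
qed (auto simp: unitary_indicator_def unitary_divisor_mult_iff)

lemma unitary_indicator_1: "unitary_indicator 1 m = (if m = 1 then 1 else 0)"
  by (auto simp: unitary_indicator_def unitary_divisor_def)

section \<open>The unitary convolution gives a ring\<close>

text \<open>
  Pointwise negation leaves the multiplicative functions, as it changes the value at \<open>1\<close>. Counting
  distinct primes is additive on coprime arguments, so the sign is multiplicative, and it is \<open>-1\<close> at
  every prime power greater than \<open>1\<close>, where the unitary convolution is a sum.
\<close>

definition unitary_neg :: "(nat \<Rightarrow> complex) \<Rightarrow> nat \<Rightarrow> complex" where
  "unitary_neg F m = (-1) ^ card (prime_factors m) * F m"

lemma unitary_neg_mult_funs:
  assumes F: "F \<in> mult_funs"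
  shows "unitary_neg F \<in> mult_funs"
proof (rule mult_funsI)
  fix a b :: nat
  assume ab: "0 < a" "0 < b" "coprime a b"
  have "prime_factors a \<inter> prime_factors b = {}"
    using ab(3) by (auto simp: in_prime_factors_iff dest: coprime_common_divisor)
  then have "card (prime_factors (a * b)) = card (prime_factors a) + card (prime_factors b)"
    using ab by (simp add: prime_factors_product card_Un_disjoint)
  then show "unitary_neg F (a * b) = unitary_neg F a * unitary_neg F b"
    using mult_funs_mult[OF F ab] by (simp add: unitary_neg_def power_add)
qed (use F in \<open>auto simp: unitary_neg_def mult_funs_0 mult_funs_1\<close>)

lemma unitary_conv_neg_left:
  assumes F: "F \<in> mult_funs"
  shows "unitary_conv (unitary_neg F) F = unitary_indicator 1"
proof (rule mult_funs_eqI_prime_power)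
  fix p k :: nat
  assume p: "prime p" and k: "0 < k"
  have "unitary_indicator 1 (p ^ k) = 0"
    using p k by (auto simp: unitary_indicator_1[simplified])
  moreover have "unitary_neg F (p ^ k) = - F (p ^ k)"
    using p k by (simp add: unitary_neg_def prime_factorization_prime_power)
  ultimately show "unitary_conv (unitary_neg F) F (p ^ k) = unitary_indicator 1 (p ^ k)"
    using unitary_conv_prime_power[OF unitary_neg_mult_funs[OF F] F p k] by simp
qed (use F in \<open>auto simp: unitary_conv_mult_funs unitary_neg_mult_funs unitary_indicator_mult_funs\<close>)

lemma unitary_conv_zero_left:
  assumes F: "F \<in> mult_funs"
  shows "unitary_conv (unitary_indicator 1) F = F"
proof (rule mult_funs_eqI_prime_power)
  fix p k :: nat
  assume p: "prime p" and k: "0 < k"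
  have "unitary_indicator 1 (p ^ k) = 0"
    using p k by (auto simp: unitary_indicator_1[simplified])
  then show "unitary_conv (unitary_indicator 1) F (p ^ k) = F (p ^ k)"
    using unitary_conv_prime_power[OF unitary_indicator_mult_funs F p k, of 1] by simp
qed (use F in \<open>auto simp: unitary_conv_mult_funs unitary_indicator_mult_funs\<close>)

lemma cring_unitary_conv:
  "cring \<lparr>carrier = mult_funs, mult = pointwise_mult, one = const_one,
     zero = unitary_indicator 1, add = unitary_conv\<rparr>" (is "cring ?R")
proof (rule cringI)
  show "abelian_group ?R"
  proof (rule abelian_groupI)
    fix F assume "F \<in> carrier ?R"
    then show "\<exists>G \<in> carrier ?R. G \<oplus>\<^bsub>?R\<^esub> F = \<zero>\<^bsub>?R\<^esub>"
      using unitary_conv_neg_left unitary_neg_mult_funs by auto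
  qed (auto simp: unitary_conv_mult_funs unitary_indicator_mult_funs unitary_conv_assoc
        unitary_conv_zero_left[simplified] intro: unitary_conv_commute)
  show "Group.comm_monoid ?R"
    by (rule comm_monoidI)
      (auto simp: pointwise_mult_mult_funs const_one_mult_funs,
       auto simp: pointwise_mult_def fun_eq_iff const_one_def mult_funs_0)
qed (simp add: unitary_conv_distrib)

section \<open>The ring axioms force the weight\<close>

text \<open>
  This reads off the weight at \<open>(a, b)\<close>. Restricting only the first factor suffices, since it
  determines the second.
\<close>

lemma W_conv_single:
  assumes "0 < a" "0 < b"
    and "\<And>c d. 0 < c \<Longrightarrow> 0 < d \<Longrightarrow> c * d = a * b \<Longrightarrow> F c \<noteq> 0 \<Longrightarrow> G d \<noteq> 0 \<Longrightarrow> c = a"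
  shows "W_conv W F G (a * b) = F a * G b * W a b"
proof -
  have "W_conv W F G (a * b) = (\<Sum>(c, d) \<in> {(a, b)}. F c * G d * W c d)"
    unfolding W_conv_def
  proof (rule sum.mono_neutral_right[OF finite_splittings])
    show "\<forall>q \<in> {(c, d). 0 < c \<and> 0 < d \<and> c * d = a * b} - {(a, b)}.
        (case q of (c, d) \<Rightarrow> F c * G d * W c d) = 0"
    proof
      fix q
      assume "q \<in> {(c, d). 0 < c \<and> 0 < d \<and> c * d = a * b} - {(a, b)}"
      then obtain c d where cd: "q = (c, d)" "0 < c" "0 < d" "c * d = a * b" "(c, d) \<noteq> (a, b)"
        by auto
      then have "c \<noteq> a" using assms(1) by auto
      then show "(case q of (c, d) \<Rightarrow> F c * G d * W c d) = 0"
        using assms(3)[of c d] cd by auto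
    qed
  qed (use assms in auto)
  then show ?thesis by simp
qed

text \<open>
  The quotients \<open>a / c\<close> and \<open>b / d\<close> are positive integers with product \<open>1\<close>. This is what lets a pair of
  unitary indicators isolate a single factorization.
\<close>

lemma mult_eq_mult_dvd_imp_eq:
  fixes a b c d :: nat
  assumes "c * d = a * b" "c dvd a" "d dvd b" "0 < a" "0 < b"
  shows "c = a"
proof -
  obtain e f where ef: "a = c * e" "b = d * f" using assms by (auto elim!: dvdE)
  with assms have "e * f = 1" by auto
  then show ?thesis using ef by simp
qed

text \<open>
  The three parts of the ring structure fix the three kinds of weight: the zero those with an
  argument \<open>1\<close>, closure under addition those at coprime pairs, distributivity the remaining ones.
\<close>

lemma weight_of_cring:
  assumes R: "cring \<lparr>carrier = mult_funs, mult = pointwise_mult, one = u, zero = z,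
      add = W_conv W\<rparr>" (is "cring ?R")
    and a: "0 < a" and b: "0 < b"
  shows "W a b = (if gcd a b = 1 then 1 else 0)"
proof -
  interpret cring ?R by (rule R)
  let ?I = unitary_indicator
  have closed: "W_conv W F G \<in> mult_funs" if "F \<in> mult_funs" "G \<in> mult_funs" for F G
    using add.m_closed[of F G] that by simp
  have distr: "pointwise_mult H (W_conv W F G) =
      W_conv W (pointwise_mult H F) (pointwise_mult H G)"
    if "F \<in> mult_funs" "G \<in> mult_funs" "H \<in> mult_funs" for F G H
    using r_distr[of F G H] that by simp
  have I: "?I n \<in> mult_funs" if "0 < n" for n
    by (rule unitary_indicator_mult_funs[OF that])
  have supp: "d dvd n" if "?I n d \<noteq> 0" for d n
    using that by (auto simp: unitary_indicator_def unitary_divisor_imp_dvd split: if_splits)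
  have z: "z = ?I 1"
  proof
    fix m
    have "pointwise_mult z (?I 1) = z" using l_null[of "?I 1"] I[of 1] by simp
    then have "z m * ?I 1 m = z m" by (auto simp: pointwise_mult_def fun_eq_iff)
    moreover have "z 1 = 1" using zero_closed by (simp add: mult_funs_1)
    ultimately show "z m = ?I 1 m" by (auto simp: unitary_indicator_1[simplified] split: if_splits)
  qed
  (* Only the factor 1 survives against the indicator of 1, so neutrality of z isolates these weights. *)
  have W1m: "W 1 m = 1" if m: "0 < m" for m
  proof -
    have "W_conv W (?I 1) const_one (1 * m) = ?I 1 1 * const_one m * W 1 m"
      by (rule W_conv_single) (use m in \<open>auto simp: unitary_indicator_1[simplified] split: if_splits\<close>)
    moreover have "W_conv W (?I 1) const_one = const_one"
      using add.l_one[of const_one] const_one_mult_funs z by simp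
    ultimately show ?thesis
      using m by (simp add: const_one_def unitary_indicator_self[simplified] unitary_indicator_1[simplified])
  qed
  have Wm1: "W m 1 = 1" if m: "0 < m" for m
  proof -
    have "W_conv W const_one (?I 1) (m * 1) = const_one m * ?I 1 1 * W m 1"
      by (rule W_conv_single) (use m in \<open>auto simp: unitary_indicator_1[simplified] split: if_splits\<close>)
    moreover have "W_conv W const_one (?I 1) = const_one"
      using add.r_one[of const_one] const_one_mult_funs z by simp
    ultimately show ?thesis
      using m by (simp add: const_one_def unitary_indicator_1[simplified])
  qed
  let ?C = "W_conv W (?I a) (?I b)"
  have C: "?C (a * b) = W a b"
  proof -
    have "?C (a * b) = ?I a a * ?I b b * W a b"
      by (rule W_conv_single[OF a b]) (use supp a b mult_eq_mult_dvd_imp_eq in blast)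
    then show ?thesis by (simp add: unitary_indicator_self)
  qed
  show ?thesis
  proof (cases "coprime a b")
    case True
    have I1: "?I n 1 = 1" if "0 < n" for n
      using I[OF that] by (simp add: mult_funs_1)
    have "?C (a * 1) = ?I a a * ?I b 1 * W a 1"
    proof (rule W_conv_single)
      fix c d
      assume cd: "c * d = a * 1" "?I b d \<noteq> 0"
      then have "d dvd a" "d dvd b" using supp by (auto intro: dvdI[of _ _ c])
      with True have "d = 1" by (metis coprime_common_divisor_nat)
      with cd show "c = a" by simp
    qed (use a in auto)
    moreover have "?C (1 * b) = ?I a 1 * ?I b b * W 1 b"
    proof (rule W_conv_single)
      fix c d
      assume cd: "c * d = 1 * b" "?I a c \<noteq> 0"
      then have "c dvd a" "c dvd b" using supp by (auto intro: dvdI[of _ _ d])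
      with True show "c = 1" by (metis coprime_common_divisor_nat)
    qed (use b in auto)
    moreover have "?C (a * b) = ?C a * ?C b"
      by (rule mult_funs_mult[OF closed[OF I[OF a] I[OF b]] a b True])
    ultimately have "W a b = 1"
      using C W1m[OF b] Wm1[OF a] I1[OF a] I1[OF b] by (simp add: unitary_indicator_self)
    then show ?thesis using True by (simp add: coprime_iff_gcd_eq_1)
  next
    case False
    (* This function is 1 at a * b but vanishes at a, which is not a unitary divisor of a * b. *)
    let ?F = "?I (a * b)"
    have "W a b = pointwise_mult ?F ?C (a * b)"
      by (simp add: C pointwise_mult_def unitary_indicator_self)
    also have "\<dots> = W_conv W (pointwise_mult ?F (?I a)) (pointwise_mult ?F (?I b)) (a * b)"
      using distr[of "?I a" "?I b" ?F] I a b by simp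
    also have "\<dots> = pointwise_mult ?F (?I a) a * pointwise_mult ?F (?I b) b * W a b"
      by (rule W_conv_single[OF a b])
        (use supp a b mult_eq_mult_dvd_imp_eq in \<open>unfold pointwise_mult_def mult_eq_0_iff, blast\<close>)
    also have "\<dots> = 0"
      using False a
      by (simp add: pointwise_mult_def unitary_indicator_def unitary_divisor_mult_left_iff)
    finally show ?thesis using False by (simp add: coprime_iff_gcd_eq_1)
  qed
qed

theorem theorem4p1:
  fixes W :: "nat \<Rightarrow> nat \<Rightarrow> complex"
  shows "forms_comm_ring mult_funs (W_conv W) pointwise_mult \<longleftrightarrow>
    (\<forall>a>0. \<forall>b>0. W a b = (if gcd a b = 1 then 1 else 0))"
proof
  assume "forms_comm_ring mult_funs (W_conv W) pointwise_mult"
  then show "\<forall>a>0. \<forall>b>0. W a b = (if gcd a b = 1 then 1 else 0)"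
    unfolding forms_comm_ring_def using weight_of_cring by blast
next
  assume "\<forall>a>0. \<forall>b>0. W a b = (if gcd a b = 1 then 1 else 0)"
  then have "W_conv W = unitary_conv" by (rule W_conv_eq_unitary_conv)
  then show "forms_comm_ring mult_funs (W_conv W) pointwise_mult"
    using cring_unitary_conv unfolding forms_comm_ring_def by metis
qed

end
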